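(* Let $\Psi_1,\Psi_2:\mathbb{R}\to\mathbb{R}$ be smooth and consider the system $$\ddot s=\Psi_1(s)+\Psi_2(s)\dot s^2$$ with state space $T\mathbb{R}=\mathbb{R}\times\mathbb{R}\ni(s,\dot s)$. Then this system is mechanical, with $M=\tilde M$ and $V=\tilde V$, where $$\tilde M(x)=\exp\Big(-2\int_0^x\Psi_2(\tau)\,d\tau\Big),\qquad \tilde V(x)=-\int_0^x\Psi_1(\tau)\tilde M(\tau)\,d\tau .$$
   Context: A system $\ddot s=\Psi_1(s)+\Psi_2(s)\dot s^2$ with state space $\mathcal X=\mathbb{R}\times\mathbb{R}$ is Euler-Lagrange (EL) with Lagrangian $L$ if $L:\mathcal X\to\mathbb{R}$ is smooth and: (i) $L$ is nondegenerate, i.e. $\partial^2L/\partial\dot s^2>0$ for all $(s,\dot s)\in\mathcal X$; (ii) all solutions $(s(t),\dot s(t))$ of the system satisfy the Euler-Lagrange equation $\frac{d}{dt}\frac{\partial L}{\partial\dot s}(s(t),\dot s(t))-\frac{\partial L}{\partial s}(s(t),\dot s(t))=0$ for all $t$ in their maximal interval of definition. The system is mechanical (with $M$ and $V$) if it is EL with Lagrangian $L(s,\dot s)=\frac12M(s)\dot s^2-V(s)$, where $M:\mathbb{R}\to(0,\infty)$ and $V:\mathbb{R}\to\mathbb{R}$ are smooth. *)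

theory Defs
  imports "HOL-Analysis.Analysis"
begin

(* On a Euclidean space, C^k means that all iterated directional derivatives of order
   at most k exist and are continuous. *)
primrec Ck :: "nat \<Rightarrow> ('a::euclidean_space \<Rightarrow> 'b::real_normed_vector) \<Rightarrow> bool" where
  "Ck 0 f \<longleftrightarrow> continuous_on UNIV f"
| "Ck (Suc k) f \<longleftrightarrow>
     (\<forall>x. f differentiable (at x)) \<and> (\<forall>v. Ck k (\<lambda>x. frechet_derivative f (at x) v))"

definition smooth :: "('a::euclidean_space \<Rightarrow> 'b::real_normed_vector) \<Rightarrow> bool" where
  "smooth f \<longleftrightarrow> (\<forall>k. Ck k f)"

definition partial_pos :: "(real \<times> real \<Rightarrow> real) \<Rightarrow> real \<times> real \<Rightarrow> real" where
  "partial_pos L = (\<lambda>(s, v). deriv (\<lambda>x. L (x, v)) s)"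

definition partial_vel :: "(real \<times> real \<Rightarrow> real) \<Rightarrow> real \<times> real \<Rightarrow> real" where
  "partial_vel L = (\<lambda>(s, v). deriv (\<lambda>x. L (s, x)) v)"

(* s is only relevant on J: J is open, so deriv s and its derivative at points of J
   do not depend on the values of s outside J. *)
definition is_solution ::
  "(real \<Rightarrow> real) \<Rightarrow> (real \<Rightarrow> real) \<Rightarrow> (real \<Rightarrow> real) \<Rightarrow> real set \<Rightarrow> bool" where
  "is_solution \<Psi>1 \<Psi>2 s J \<longleftrightarrow>
     open J \<and> is_interval J \<and> J \<noteq> {} \<and>
     (\<forall>t\<in>J. s field_differentiable at t \<and>
        (deriv s has_real_derivative (\<Psi>1 (s t) + \<Psi>2 (s t) * (deriv s t)\<^sup>2)) (at t))"

definition is_maximal_solution ::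
  "(real \<Rightarrow> real) \<Rightarrow> (real \<Rightarrow> real) \<Rightarrow> (real \<Rightarrow> real) \<Rightarrow> real set \<Rightarrow> bool" where
  "is_maximal_solution \<Psi>1 \<Psi>2 s J \<longleftrightarrow>
     is_solution \<Psi>1 \<Psi>2 s J \<and>
     (\<forall>s' J'. is_solution \<Psi>1 \<Psi>2 s' J' \<and> J \<subseteq> J' \<and> (\<forall>t\<in>J. s' t = s t) \<longrightarrow> J' = J)"

definition nondegenerate :: "(real \<times> real \<Rightarrow> real) \<Rightarrow> bool" where
  "nondegenerate L \<longleftrightarrow> (\<forall>p. partial_vel (partial_vel L) p > 0)"

(* The existence of the time derivative is part of the equation, since deriv is total. *)
definition satisfies_EL_at :: "(real \<times> real \<Rightarrow> real) \<Rightarrow> (real \<Rightarrow> real) \<Rightarrow> real \<Rightarrow> bool" where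
  "satisfies_EL_at L s t \<longleftrightarrow>
     (\<lambda>\<tau>. partial_vel L (s \<tau>, deriv s \<tau>)) field_differentiable at t \<and>
     deriv (\<lambda>\<tau>. partial_vel L (s \<tau>, deriv s \<tau>)) t - partial_pos L (s t, deriv s t) = 0"

definition euler_lagrange ::
  "(real \<Rightarrow> real) \<Rightarrow> (real \<Rightarrow> real) \<Rightarrow> (real \<times> real \<Rightarrow> real) \<Rightarrow> bool" where
  "euler_lagrange \<Psi>1 \<Psi>2 L \<longleftrightarrow>
     smooth L \<and> nondegenerate L \<and>
     (\<forall>s J. is_maximal_solution \<Psi>1 \<Psi>2 s J \<longrightarrow> (\<forall>t\<in>J. satisfies_EL_at L s t))"

definition mechanical ::
  "(real \<Rightarrow> real) \<Rightarrow> (real \<Rightarrow> real) \<Rightarrow> (real \<Rightarrow> real) \<Rightarrow> (real \<Rightarrow> real) \<Rightarrow> bool" where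
  "mechanical \<Psi>1 \<Psi>2 M V \<longleftrightarrow>
     smooth M \<and> (\<forall>x. M x > 0) \<and> smooth V \<and>
     euler_lagrange \<Psi>1 \<Psi>2 (\<lambda>(s, v). 1 / 2 * M s * v\<^sup>2 - V s)"

(* The interval integral LBINT is oriented: for x < 0 it equals minus the integral over {x..0}. *)
definition M_tilde :: "(real \<Rightarrow> real) \<Rightarrow> real \<Rightarrow> real" where
  "M_tilde \<Psi>2 x = exp (- 2 * (LBINT \<tau>=0..x. \<Psi>2 \<tau>))"

definition V_tilde :: "(real \<Rightarrow> real) \<Rightarrow> (real \<Rightarrow> real) \<Rightarrow> real \<Rightarrow> real" where
  "V_tilde \<Psi>1 \<Psi>2 x = - (LBINT \<tau>=0..x. \<Psi>1 \<tau> * M_tilde \<Psi>2 \<tau>)"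

end

theory Submission
  imports Defs
begin

text \<open>
  Write \<open>M\<close> and \<open>V\<close> for the two functions of the theorem. By the fundamental theorem of calculus,
  \<open>M' = - 2 \<Psi>2 M\<close> and \<open>V' = - \<Psi>1 M\<close>, and these two equations carry everything.

  The Euler-Lagrange equation: the momentum of \<open>L = M(s) v\<^sup>2 / 2 - V(s)\<close> is \<open>M(s) v\<close>. Along a
  solution its time derivative is \<open>M' v\<^sup>2 + M (\<Psi>1 + \<Psi>2 v\<^sup>2) = M (\<Psi>1 - \<Psi>2 v\<^sup>2)\<close>, and the partial
  derivative of \<open>L\<close> in \<open>s\<close>, namely \<open>M' v\<^sup>2 / 2 - V'\<close>, has the same value
  (\<open>mechanical_Lagrangian_satisfies_EL\<close>).

  Smoothness: the linear equation for \<open>M\<close> bootstraps one order of differentiability of \<open>M\<close> into the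
  next (\<open>smooth_if_linear_ODE\<close>), so the exponential needs no chain rule of higher order. Then \<open>V\<close> is
  smooth because its derivative is, and \<open>L\<close> is smooth by the closure of \<open>C\<^sup>k\<close> under sums, products
  and composition with linear maps. Finally \<open>L\<close> is nondegenerate since its second derivative in \<open>v\<close>
  is \<open>M(s) > 0\<close>.
\<close>

section \<open>Closure properties of \<open>C\<^sup>k\<close> functions\<close>

text \<open>The predicate \<open>Ck\<close> is phrased with \<open>frechet_derivative\<close>; this rule establishes it from any
  family of derivatives that one can write down.\<close>
lemma Ck_SucI:
  assumes "\<And>x. (f has_derivative D x) (at x)" and "\<And>v. Ck k (\<lambda>x. D x v)"
  shows "Ck (Suc k) f"
proof -
  have "frechet_derivative f (at x) = D x" for x
    using frechet_derivative_at[OF assms(1)] by simp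
  then show ?thesis
    using assms by (auto simp: differentiable_def)
qed

lemma Ck_Suc_has_derivative:
  "Ck (Suc k) f \<Longrightarrow> (f has_derivative frechet_derivative f (at x)) (at x)"
  by (simp add: frechet_derivative_works)

lemma Ck_SucD: "Ck (Suc k) f \<Longrightarrow> Ck k f"
proof (induction k arbitrary: f)
  case 0
  then show ?case
    by (auto simp: continuous_on_eq_continuous_at differentiable_imp_continuous_within)
next
  case (Suc k)
  then show ?case
    using Ck.simps(2) by blast
qed

lemma Ck_const: "Ck k (\<lambda>x. c)"
proof (induction k arbitrary: c)
  case (Suc k)
  show ?case
    by (rule Ck_SucI[where D = "\<lambda>x v. 0"]) (auto intro: Suc)
qed simp

lemma Ck_bounded_linear:
  assumes "bounded_linear h"
  shows "Ck k h"
proof (cases k)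
  case 0
  then show ?thesis
    using assms by (simp add: linear_continuous_on)
next
  case (Suc j)
  show ?thesis
    unfolding Suc
    by (rule Ck_SucI[where D = "\<lambda>x. h"])
      (auto intro: Ck_const bounded_linear_imp_has_derivative assms)
qed

lemma Ck_add: "Ck k f \<Longrightarrow> Ck k g \<Longrightarrow> Ck k (\<lambda>x. f x + g x)"
proof (induction k arbitrary: f g)
  case 0
  then show ?case by (auto intro: continuous_intros)
next
  case (Suc k)
  show ?case
  proof (rule Ck_SucI)
    show "((\<lambda>x. f x + g x) has_derivative
        (\<lambda>v. frechet_derivative f (at x) v + frechet_derivative g (at x) v)) (at x)" for x
      by (intro has_derivative_add Suc.prems[THEN Ck_Suc_has_derivative])
    show "Ck k (\<lambda>x. frechet_derivative f (at x) v + frechet_derivative g (at x) v)" for v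
      using Suc by simp
  qed
qed

lemma Ck_mult:
  fixes f g :: "'a::euclidean_space \<Rightarrow> 'b::real_normed_algebra"
  shows "Ck k f \<Longrightarrow> Ck k g \<Longrightarrow> Ck k (\<lambda>x. f x * g x)"
proof (induction k arbitrary: f g)
  case 0
  then show ?case by (auto intro: continuous_intros)
next
  case (Suc k)
  show ?case
  proof (rule Ck_SucI)
    show "((\<lambda>x. f x * g x) has_derivative
        (\<lambda>v. f x * frechet_derivative g (at x) v + frechet_derivative f (at x) v * g x)) (at x)" for x
      by (intro has_derivative_mult Suc.prems[THEN Ck_Suc_has_derivative])
    show "Ck k (\<lambda>x. f x * frechet_derivative g (at x) v + frechet_derivative f (at x) v * g x)" for v
      using Suc.prems Suc.prems[THEN Ck_SucD] by (intro Ck_add Suc.IH) auto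
  qed
qed

lemma Ck_compose_bounded_linear:
  assumes "bounded_linear h"
  shows "Ck k f \<Longrightarrow> Ck k (\<lambda>x. f (h x))"
proof (induction k arbitrary: f)
  case 0
  then have "continuous_on (range h) f"
    by (auto intro: continuous_on_subset)
  then show ?case
    using continuous_on_compose2[OF _ linear_continuous_on[OF assms], of "range h" f UNIV] by simp
next
  case (Suc k)
  show ?case
  proof (rule Ck_SucI)
    show "((\<lambda>x. f (h x)) has_derivative (\<lambda>v. frechet_derivative f (at (h x)) (h v))) (at x)" for x
      using has_derivative_compose[OF bounded_linear_imp_has_derivative[OF assms]
          Ck_Suc_has_derivative[OF Suc.prems]] .
    show "Ck k (\<lambda>x. frechet_derivative f (at (h x)) (h v))" for v
      using Suc.IH[of "\<lambda>y. frechet_derivative f (at y) (h v)"] Suc.prems by simp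
  qed
qed

lemma Ck_Suc_real:
  fixes f :: "real \<Rightarrow> real"
  assumes "\<And>x. (f has_real_derivative f' x) (at x)" and "Ck k f'"
  shows "Ck (Suc k) f"
proof (rule Ck_SucI)
  show "(f has_derivative (\<lambda>v. f' x * v)) (at x)" for x
    using assms(1) by (simp add: has_field_derivative_def)
  show "Ck k (\<lambda>x. f' x * v)" for v
    by (intro Ck_mult Ck_const assms(2))
qed

lemma smooth_imp_continuous: "smooth f \<Longrightarrow> continuous_on UNIV f"
  unfolding smooth_def by (metis Ck.simps(1))

text \<open>A solution of a scalar homogeneous linear equation with smooth coefficient is smooth: each
  order of differentiability of \<open>f\<close> yields the next one through the equation.\<close>
lemma smooth_if_linear_ODE:
  fixes f a :: "real \<Rightarrow> real"
  assumes "\<And>x. (f has_real_derivative a x * f x) (at x)" and "smooth a"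
  shows "smooth f"
proof -
  have "Ck k f" for k
  proof (induction k)
    case 0
    show ?case
      using assms(1) by (auto intro!: continuous_at_imp_continuous_on DERIV_isCont)
  next
    case (Suc k)
    then have "Ck k (\<lambda>x. a x * f x)"
      using assms(2) by (intro Ck_mult) (auto simp: smooth_def)
    then show ?case
      by (rule Ck_Suc_real[OF assms(1)])
  qed
  then show ?thesis
    by (simp add: smooth_def)
qed

lemma smooth_if_smooth_derivative:
  fixes f f' :: "real \<Rightarrow> real"
  assumes "\<And>x. (f has_real_derivative f' x) (at x)" and "smooth f'"
  shows "smooth f"
  using assms Ck_Suc_real Ck_SucD unfolding smooth_def by blast

lemma smooth_mult:
  fixes f g :: "'a::euclidean_space \<Rightarrow> 'b::real_normed_algebra"
  shows "smooth f \<Longrightarrow> smooth g \<Longrightarrow> smooth (\<lambda>x. f x * g x)"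
  by (simp add: smooth_def Ck_mult)

lemma smooth_const: "smooth (\<lambda>x. c)"
  by (simp add: smooth_def Ck_const)

lemma smooth_mechanical_Lagrangian:
  fixes M V :: "real \<Rightarrow> real"
  assumes "smooth M" and "smooth V"
  shows "smooth (\<lambda>(s, v). 1 / 2 * M s * v\<^sup>2 - V s)"
proof -
  have "Ck k (\<lambda>p::real \<times> real. 1 / 2 * M (fst p) * (snd p * snd p) + - 1 * V (fst p))" for k
    using assms unfolding smooth_def
    by (intro Ck_add Ck_mult Ck_const Ck_compose_bounded_linear[OF bounded_linear_fst]
        Ck_bounded_linear[OF bounded_linear_snd]) auto
  moreover have "(\<lambda>p. 1 / 2 * M (fst p) * (snd p * snd p) + - 1 * V (fst p)) =
      (\<lambda>(s, v). 1 / 2 * M s * v\<^sup>2 - V s)"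
    by (auto simp: power2_eq_square)
  ultimately show ?thesis
    by (simp only: smooth_def) simp
qed

section \<open>The differential equations of the mass and the potential\<close>

text \<open>The fundamental theorem of calculus for the oriented integral, on both sides of \<open>0\<close>.\<close>
lemma has_real_derivative_LBINT:
  fixes f :: "real \<Rightarrow> real"
  assumes "continuous_on UNIV f"
  shows "((\<lambda>x. LBINT t=0..x. f t) has_real_derivative f x) (at x)"
proof -
  \<comment> \<open>A compact interval with \<open>0\<close> and \<open>x\<close> in its interior, whichever the sign of \<open>x\<close>.\<close>
  define b where "b = \<bar>x\<bar> + 1"
  have "continuous_on {-b..b} f"
    using assms by (rule continuous_on_subset) simp
  then have "((\<lambda>u. LBINT t=0..u. f t) has_vector_derivative f x) (at x within {-b..b})"
    using interval_integral_FTC2[of "-b" 0 b f x] by (simp add: b_def zero_ereal_def abs_if)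
  moreover have "at x within {-b..b} = at x"
    by (rule at_within_interior) (auto simp: b_def)
  ultimately show ?thesis
    by (simp add: has_real_derivative_iff_has_vector_derivative)
qed

lemma M_tilde_pos: "M_tilde \<Psi>2 x > 0"
  by (simp add: M_tilde_def)

lemma M_tilde_has_derivative:
  assumes "continuous_on UNIV \<Psi>2"
  shows "(M_tilde \<Psi>2 has_real_derivative - 2 * \<Psi>2 x * M_tilde \<Psi>2 x) (at x)"
  unfolding M_tilde_def
  by (auto intro!: derivative_eq_intros has_real_derivative_LBINT assms)

lemma smooth_M_tilde:
  assumes "smooth \<Psi>2"
  shows "smooth (M_tilde \<Psi>2)"
proof (rule smooth_if_linear_ODE)
  show "smooth (\<lambda>x. - 2 * \<Psi>2 x)"
    by (intro smooth_mult smooth_const assms)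
qed (rule M_tilde_has_derivative[OF smooth_imp_continuous[OF assms]])

lemma V_tilde_has_derivative:
  assumes "continuous_on UNIV \<Psi>1" and "continuous_on UNIV \<Psi>2"
  shows "(V_tilde \<Psi>1 \<Psi>2 has_real_derivative - (\<Psi>1 x * M_tilde \<Psi>2 x)) (at x)"
proof -
  have "continuous_on UNIV (M_tilde \<Psi>2)"
    using M_tilde_has_derivative[OF assms(2)]
    by (auto intro!: continuous_at_imp_continuous_on DERIV_isCont)
  then show ?thesis
    unfolding V_tilde_def
    by (intro DERIV_minus has_real_derivative_LBINT continuous_on_mult assms(1))
qed

lemma smooth_V_tilde:
  assumes "smooth \<Psi>1" and "smooth \<Psi>2"
  shows "smooth (V_tilde \<Psi>1 \<Psi>2)"
proof (rule smooth_if_smooth_derivative)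
  show "smooth (\<lambda>x. - (\<Psi>1 x * M_tilde \<Psi>2 x))"
    using smooth_mult[OF smooth_const[of "- 1"] smooth_mult[OF assms(1) smooth_M_tilde[OF assms(2)]]]
    by simp
qed (intro V_tilde_has_derivative smooth_imp_continuous assms)

section \<open>The Euler-Lagrange equation of a mechanical Lagrangian\<close>

lemma partial_vel_mechanical_Lagrangian:
  "partial_vel (\<lambda>(s, v). 1 / 2 * M s * v\<^sup>2 - V s) = (\<lambda>(s, v). M s * v)"
  unfolding partial_vel_def
  by (auto intro!: ext DERIV_imp_deriv derivative_eq_intros)

lemma partial_pos_mechanical_Lagrangian:
  assumes "(M has_real_derivative M') (at s)" and "(V has_real_derivative V') (at s)"
  shows "partial_pos (\<lambda>(s, v). 1 / 2 * M s * v\<^sup>2 - V s) (s, v) = 1 / 2 * M' * v\<^sup>2 - V'"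
  unfolding partial_pos_def
  by (auto intro!: DERIV_imp_deriv derivative_eq_intros assms)

lemma nondegenerate_mechanical_Lagrangian:
  assumes "\<And>x. M x > 0"
  shows "nondegenerate (\<lambda>(s, v). 1 / 2 * M s * v\<^sup>2 - V s)"
proof -
  have "partial_vel (\<lambda>(s, v). M s * v) p = M (fst p)" for p
    unfolding partial_vel_def
    by (auto simp: case_prod_beta intro!: DERIV_imp_deriv derivative_eq_intros)
  then show ?thesis
    using assms by (simp only: nondegenerate_def partial_vel_mechanical_Lagrangian) simp
qed

text \<open>The equation is local in time, so it holds along every solution, maximal or not.\<close>
lemma mechanical_Lagrangian_satisfies_EL:
  assumes M: "\<And>x. (M has_real_derivative - 2 * \<Psi>2 x * M x) (at x)"
    and V: "\<And>x. (V has_real_derivative - (\<Psi>1 x * M x)) (at x)"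
    and sol: "is_solution \<Psi>1 \<Psi>2 s J" and t: "t \<in> J"
  shows "satisfies_EL_at (\<lambda>(s, v). 1 / 2 * M s * v\<^sup>2 - V s) s t"
proof -
  have s: "(s has_real_derivative deriv s t) (at t)"
    and s': "(deriv s has_real_derivative \<Psi>1 (s t) + \<Psi>2 (s t) * (deriv s t)\<^sup>2) (at t)"
    using sol t by (auto simp: is_solution_def DERIV_deriv_iff_field_differentiable)
  have "((\<lambda>\<tau>. M (s \<tau>) * deriv s \<tau>) has_real_derivative
      M (s t) * (\<Psi>1 (s t) - \<Psi>2 (s t) * (deriv s t)\<^sup>2)) (at t)"
    by (rule derivative_eq_intros DERIV_chain2[OF M s] s' refl)+
      (simp add: algebra_simps power2_eq_square)
  then show ?thesis
    unfolding satisfies_EL_at_def partial_vel_mechanical_Lagrangian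
      partial_pos_mechanical_Lagrangian[OF M V]
    by (auto simp: DERIV_imp_deriv field_differentiable_def algebra_simps)
qed

theorem theorem3p3:
  fixes \<Psi>1 \<Psi>2 :: "real \<Rightarrow> real"
  assumes "smooth \<Psi>1" and "smooth \<Psi>2"
  shows "mechanical \<Psi>1 \<Psi>2 (M_tilde \<Psi>2) (V_tilde \<Psi>1 \<Psi>2)"
proof -
  have "satisfies_EL_at (\<lambda>(s, v). 1 / 2 * M_tilde \<Psi>2 s * v\<^sup>2 - V_tilde \<Psi>1 \<Psi>2 s) s t"
    if "is_maximal_solution \<Psi>1 \<Psi>2 s J" and "t \<in> J" for s J t
    using that assms
    by (intro mechanical_Lagrangian_satisfies_EL[where J = J and ?\<Psi>1.0 = \<Psi>1 and ?\<Psi>2.0 = \<Psi>2]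
        M_tilde_has_derivative V_tilde_has_derivative smooth_imp_continuous)
      (auto simp: is_maximal_solution_def)
  then show ?thesis
    unfolding mechanical_def euler_lagrange_def
    using assms M_tilde_pos
    by (blast intro: smooth_M_tilde smooth_V_tilde smooth_mechanical_Lagrangian
        nondegenerate_mechanical_Lagrangian)
qed

end
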